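(* Let $n>1$, $d>1$ be integers. Let $P$ be a real homogeneous polynomial in $n$ variables, of degree $d$ and Bombieri norm $1$, such that $\mathrm{dist}(P,\Delta)$ is locally maximal among polynomials (in $\mathbb{E}=\mathbb{R}[X_1,\dots,X_n]_d$) of Bombieri norm $1$. Let $\{c_1,-c_1,\dots,c_k,-c_k\}$ be the set of the quasi-singular points of $P$, and let $R_1,\dots,R_k$ be the corresponding contact radii, $R_i$ being the contact radius for $P$ at $c_i$ (one is chosen for each pair $(c_i,-c_i)$). Then $P$ is a linear combination of $R_1,\dots,R_k$.
   Context: $\mathcal{S}^{n-1}$ is the unit sphere of $\mathbb{R}^n$. The Bombieri norm on $\mathbb{E}$ is the norm of the scalar product for which distinct monomials are orthogonal and $\|x^\alpha\|^2=\alpha!/d!$ for $|\alpha|=d$ (where $\alpha!=\prod_i\alpha_i!$). For $x\in\mathcal{S}^{n-1}$ let $\Delta_x=\{Q\in\mathbb{E}:Q(x)=0,\ \nabla Q(x)=0\}$, and let $\Delta=\bigcup_{x\in\mathcal{S}^{n-1}}\Delta_x$ be the real discriminant; $\mathrm{dist}$ is the distance for the Bombieri norm. For $x\in\mathcal{S}^{n-1}$, $\nabla^TP(x)=\nabla P(x)-\langle x\mid\nabla P(x)\rangle x$. A point $c\in\mathcal{S}^{n-1}$ is quasi-singular for $P$ if $\mathrm{dist}(P,\Delta)^2=P(c)^2+\|\nabla^TP(c)\|^2/d$ (equivalently $\mathrm{dist}(P,\Delta)=\mathrm{dist}(P,\Delta_c)$). A contact polynomial for $P$ at a quasi-singular point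 $c$ is $Q\in\Delta_c$ with $\|Q-P\|=\mathrm{dist}(P,\Delta)$ (it is the orthogonal projection of $P$ on the linear subspace $\Delta_c$); the contact radius for $P$ at $c$ is $R=Q-P$. *)

theory Defs
  imports "HOL-Analysis.Analysis" "HOL-Library.Poly_Mapping"
begin

text \<open>
  Multivariate real polynomials in the variables \<open>X\<^sub>i\<close>, \<open>i :: 'n\<close>: finitely supported maps from
  exponents to coefficients. The number of variables is \<open>n = CARD('n)\<close>.
\<close>

type_synonym 'n exponent = "'n \<Rightarrow>\<^sub>0 nat"
type_synonym 'n mpoly = "'n exponent \<Rightarrow>\<^sub>0 real"

definition total_deg :: "'n::finite exponent \<Rightarrow> nat" where
  "total_deg \<alpha> = (\<Sum>i\<in>UNIV. Poly_Mapping.lookup \<alpha> i)"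

definition mfact :: "'n::finite exponent \<Rightarrow> nat" where
  "mfact \<alpha> = (\<Prod>i\<in>UNIV. fact (Poly_Mapping.lookup \<alpha> i))"

definition homogeneous :: "nat \<Rightarrow> 'n::finite mpoly set" where
  "homogeneous d = {P. \<forall>\<alpha>\<in>Poly_Mapping.keys P. total_deg \<alpha> = d}"

definition smult_mpoly :: "real \<Rightarrow> 'n mpoly \<Rightarrow> 'n mpoly" where
  "smult_mpoly a P = Poly_Mapping.map ((*) a) P"

definition peval :: "'n::finite mpoly \<Rightarrow> real ^ 'n \<Rightarrow> real" where
  "peval P x = (\<Sum>\<alpha>\<in>Poly_Mapping.keys P.
     Poly_Mapping.lookup P \<alpha> * (\<Prod>i\<in>UNIV. (x $ i) ^ Poly_Mapping.lookup \<alpha> i))"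

definition grad :: "'n::finite mpoly \<Rightarrow> real ^ 'n \<Rightarrow> real ^ 'n" where
  "grad P x = (THE g. GDERIV (peval P) x :> g)"

lemma GDERIV_grad:
  fixes P :: "'n::finite mpoly"
  shows "GDERIV (peval P) x :> grad P x"
proof -
  have "(peval P) differentiable at x"
  proof -
    have "(\<lambda>x. \<Prod>i\<in>UNIV. (x $ i) ^ Poly_Mapping.lookup \<alpha> i) differentiable at x"
      for \<alpha> :: "'n exponent"
    proof -
      have "((\<lambda>x. (x $ i) ^ k) has_derivative
              (\<lambda>h. of_nat k * h $ i * (x $ i) ^ (k - 1))) (at x)" for i :: 'n and k
        by (intro has_derivative_power bounded_linear_imp_has_derivative
            bounded_linear_vec_nth)
      from has_derivative_prod[OF this, of "\<lambda>i. i" "Poly_Mapping.lookup \<alpha>" UNIV]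
      show ?thesis by (rule differentiableI)
    qed
    then show ?thesis
      unfolding peval_def [abs_def]
      by (intro differentiable_sum differentiable_mult differentiable_const finite_keys ballI)
  qed
  then obtain f where f: "(peval P has_derivative f) (at x)"
    unfolding differentiable_def by blast
  then have lin: "linear f" by (rule has_derivative_linear)
  have "f = (\<lambda>h. h \<bullet> adjoint f 1)"
    using adjoint_works[OF lin, of _ 1] by auto
  with f have ex: "GDERIV (peval P) x :> adjoint f 1"
    unfolding gderiv_def by simp
  have "D = adjoint f 1" if "GDERIV (peval P) x :> D" for D
  proof -
    have "(\<lambda>h. h \<bullet> D) = (\<lambda>h. h \<bullet> adjoint f 1)"
      by (rule has_derivative_unique[OF that[unfolded gderiv_def] ex[unfolded gderiv_def]])
    then show ?thesis
      by (metis vector_eq_ldot)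
  qed
  with ex show ?thesis unfolding grad_def by (rule theI)
qed

definition tgrad :: "'n::finite mpoly \<Rightarrow> real ^ 'n \<Rightarrow> real ^ 'n" where
  "tgrad P x = grad P x - (x \<bullet> grad P x) *\<^sub>R x"

text \<open>
  The weight of a monomial of degree \<open>d\<close> is \<open>\<alpha>! / d!\<close>; writing \<open>d = total_deg \<alpha>\<close> avoids a degree
  parameter. Only homogeneous polynomials of one fixed degree are ever compared.
\<close>

definition bombieri_inner :: "'n::finite mpoly \<Rightarrow> 'n mpoly \<Rightarrow> real" where
  "bombieri_inner P Q = (\<Sum>\<alpha>\<in>Poly_Mapping.keys P \<union> Poly_Mapping.keys Q.
     real (mfact \<alpha>) / fact (total_deg \<alpha>) * Poly_Mapping.lookup P \<alpha> * Poly_Mapping.lookup Q \<alpha>)"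

definition bombieri_norm :: "'n::finite mpoly \<Rightarrow> real" where
  "bombieri_norm P = sqrt (bombieri_inner P P)"

definition bombieri_dist :: "'n::finite mpoly \<Rightarrow> 'n mpoly set \<Rightarrow> real" where
  "bombieri_dist P S = (INF Q\<in>S. bombieri_norm (P - Q))"

definition disc_at :: "nat \<Rightarrow> real ^ 'n \<Rightarrow> 'n::finite mpoly set" where
  "disc_at d x = {Q \<in> homogeneous d. peval Q x = 0 \<and> grad Q x = 0}"

definition real_disc :: "nat \<Rightarrow> 'n::finite mpoly set" where
  "real_disc d = (\<Union>x\<in>sphere 0 1. disc_at d x)"

definition quasi_singular :: "nat \<Rightarrow> 'n::finite mpoly \<Rightarrow> real ^ 'n \<Rightarrow> bool" where
  "quasi_singular d P c \<longleftrightarrow> c \<in> sphere 0 1 \<and>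
     (bombieri_dist P (real_disc d))\<^sup>2 = (peval P c)\<^sup>2 + (norm (tgrad P c))\<^sup>2 / real d"

definition contact_polynomial ::
  "nat \<Rightarrow> 'n::finite mpoly \<Rightarrow> real ^ 'n \<Rightarrow> 'n mpoly \<Rightarrow> bool" where
  "contact_polynomial d P c Q \<longleftrightarrow> quasi_singular d P c \<and> Q \<in> disc_at d c \<and>
     bombieri_norm (Q - P) = bombieri_dist P (real_disc d)"

definition contact_radius ::
  "nat \<Rightarrow> 'n::finite mpoly \<Rightarrow> real ^ 'n \<Rightarrow> 'n mpoly \<Rightarrow> bool" where
  "contact_radius d P c R \<longleftrightarrow> (\<exists>Q. contact_polynomial d P c Q \<and> R = Q - P)"

definition locally_max_dist :: "nat \<Rightarrow> 'n::finite mpoly \<Rightarrow> bool" where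
  "locally_max_dist d P \<longleftrightarrow>
     (\<exists>\<epsilon>>0. \<forall>Q\<in>homogeneous d. bombieri_norm Q = 1 \<longrightarrow> bombieri_norm (Q - P) < \<epsilon> \<longrightarrow>
        bombieri_dist Q (real_disc d) \<le> bombieri_dist P (real_disc d))"

end

theory Submission
  imports Defs
begin

text \<open>
  Write \<open>\<delta> = dist(P, \<Delta>)\<close>. The polynomials \<open>\<langle>u, X\<rangle> \<langle>x, X\<rangle>^(d-1)\<close> represent the functionals
  \<open>Q \<mapsto> \<langle>u, \<nabla>Q(x)\<rangle> / d\<close> for the Bombieri product, so they span the complement of \<open>\<Delta>\<^sub>x\<close> and
  \<open>f\<^sub>x(Q) = Q(x)\<^sup>2 + \<parallel>\<nabla>\<^sup>TQ(x)\<parallel>\<^sup>2/d\<close> is the squared distance of \<open>Q\<close> to \<open>\<Delta>\<^sub>x\<close>.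

  Let \<open>N\<close> be the component of \<open>P\<close> orthogonal to all \<open>R\<^sub>i\<close>, and suppose \<open>N \<noteq> 0\<close>. At a quasi-singular
  point, moving from \<open>P\<close> to \<open>P - tN\<close> leaves \<open>f\<^sub>x\<close> unchanged to first order, while the squared norm
  drops by \<open>2t\<parallel>N\<parallel>\<^sup>2\<close>. By compactness of the sphere \<open>f\<^sub>x(P - tN) > \<delta>\<^sup>2\<parallel>P - tN\<parallel>\<^sup>2\<close> for all \<open>x\<close> and all small
  \<open>t > 0\<close>, so that normalizing \<open>P - tN\<close> contradicts local maximality.

  This needs \<open>\<delta> > 0\<close>. If \<open>\<delta> = 0\<close>, the quasi-singular points are the finitely many real singular
  points of \<open>P\<close>, and a small generic perturbation of \<open>P\<close> has no singular point at all.
\<close>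

subsection \<open>Evaluation and partial derivatives of polynomials\<close>

definition monom_eval :: "'n::finite exponent \<Rightarrow> real ^ 'n \<Rightarrow> real" where
  "monom_eval \<alpha> x = (\<Prod>i\<in>UNIV. (x $ i) ^ Poly_Mapping.lookup \<alpha> i)"

text \<open>The squared Bombieri norm of a monomial.\<close>

definition weight :: "'n::finite exponent \<Rightarrow> real" where
  "weight \<alpha> = real (mfact \<alpha>) / fact (total_deg \<alpha>)"

text \<open>Exponent subtraction truncates at 0. For a monomial free of the variable the factor
  \<open>Poly_Mapping.lookup \<alpha> i\<close> is 0, so the wrong exponent does no harm.\<close>

definition partial_deriv :: "'n::finite \<Rightarrow> 'n mpoly \<Rightarrow> 'n mpoly" where
  "partial_deriv i P = (\<Sum>\<alpha>\<in>Poly_Mapping.keys P. Poly_Mapping.single (\<alpha> - Poly_Mapping.single i 1)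
     (real (Poly_Mapping.lookup \<alpha> i) * Poly_Mapping.lookup P \<alpha>))"

definition linear_form :: "real ^ 'n \<Rightarrow> 'n::finite mpoly" where
  "linear_form u = (\<Sum>i\<in>UNIV. Poly_Mapping.single (Poly_Mapping.single i 1) (u $ i))"

lemma mpoly_eq_sum_single:
  "(\<Sum>\<alpha>\<in>Poly_Mapping.keys P. Poly_Mapping.single \<alpha> (Poly_Mapping.lookup P \<alpha>)) = (P :: 'n mpoly)"
  by (rule poly_mapping_eqI)
    (auto simp: lookup_sum lookup_single when_def in_keys_iff)

text \<open>A polynomial is the finite sum of its terms, added one by one. Confining the monomial
  case to the keys of \<open>P\<close> lets homogeneity pass through the induction.\<close>

lemma mpoly_keys_induct [case_names zero monom add]:
  fixes P :: "'n mpoly"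
  assumes "\<phi> 0"
    and "\<And>\<alpha> a. \<alpha> \<in> Poly_Mapping.keys P \<Longrightarrow> \<phi> (Poly_Mapping.single \<alpha> a)"
    and "\<And>Q R. \<phi> Q \<Longrightarrow> \<phi> R \<Longrightarrow> \<phi> (Q + R)"
  shows "\<phi> P"
proof -
  have "\<phi> (\<Sum>\<alpha>\<in>A. Poly_Mapping.single \<alpha> (Poly_Mapping.lookup P \<alpha>))"
    if "finite A" "A \<subseteq> Poly_Mapping.keys P" for A
    using that by (induction rule: finite_induct) (auto intro: assms)
  from this[of "Poly_Mapping.keys P"] show ?thesis
    by (simp add: mpoly_eq_sum_single)
qed

lemma mpoly_induct [case_names zero monom add]:
  fixes P :: "'n mpoly"
  assumes "\<phi> 0" and "\<And>\<alpha> a. \<phi> (Poly_Mapping.single \<alpha> a)"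
    and "\<And>Q R. \<phi> Q \<Longrightarrow> \<phi> R \<Longrightarrow> \<phi> (Q + R)"
  shows "\<phi> P"
  by (rule mpoly_keys_induct[where \<phi> = \<phi>]) (rule assms; assumption)+

lemma homogeneous_induct [consumes 1, case_names zero monom add]:
  assumes "P \<in> homogeneous d" and "\<phi> 0"
    and "\<And>\<alpha> a. total_deg \<alpha> = d \<Longrightarrow> \<phi> (Poly_Mapping.single \<alpha> a)"
    and "\<And>Q R. \<phi> Q \<Longrightarrow> \<phi> R \<Longrightarrow> \<phi> (Q + R)"
  shows "\<phi> P"
proof (rule mpoly_keys_induct[where \<phi> = \<phi>])
  show "\<phi> (Poly_Mapping.single \<alpha> a)" if "\<alpha> \<in> Poly_Mapping.keys P" for \<alpha> a
    using assms(1) that by (intro assms(3)) (simp add: homogeneous_def)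
qed (rule assms; assumption)+

section \<open>Scaling, degrees and homogeneity\<close>

lemma lookup_smult_mpoly [simp]:
  "Poly_Mapping.lookup (smult_mpoly a P) \<alpha> = a * Poly_Mapping.lookup P \<alpha>"
  unfolding smult_mpoly_def by (transfer) (auto simp: when_def)

lemma smult_mpoly_eq: "smult_mpoly a P = Poly_Mapping.single 0 a * P"
  unfolding smult_mpoly_def by (rule mult_map_scale_conv_mult)

lemma total_deg_add: "total_deg (\<alpha> + \<beta>) = total_deg \<alpha> + total_deg \<beta>"
  by (simp add: total_deg_def lookup_add sum.distrib)

lemma total_deg_single [simp]: "total_deg (Poly_Mapping.single i k) = k"
  by (simp add: total_deg_def lookup_single when_def)

lemma total_deg_eq_0_iff: "total_deg \<alpha> = 0 \<longleftrightarrow> \<alpha> = 0"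
  by (auto simp: total_deg_def poly_mapping_eq_iff fun_eq_iff)

lemma homogeneous_0 [simp]: "0 \<in> homogeneous d"
  by (simp add: homogeneous_def)

lemma homogeneous_single [simp]:
  "total_deg \<alpha> = d \<Longrightarrow> Poly_Mapping.single \<alpha> a \<in> homogeneous d"
  by (simp add: homogeneous_def)

lemma homogeneous_add: "P \<in> homogeneous d \<Longrightarrow> Q \<in> homogeneous d \<Longrightarrow> P + Q \<in> homogeneous d"
  using keys_add[of P Q] by (auto simp: homogeneous_def)

lemma homogeneous_sum: "(\<And>i. i \<in> I \<Longrightarrow> P i \<in> homogeneous d) \<Longrightarrow> (\<Sum>i\<in>I. P i) \<in> homogeneous d"
  by (induction I rule: infinite_finite_induct) (auto intro: homogeneous_add)

lemma homogeneous_mult: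
  "P \<in> homogeneous d \<Longrightarrow> Q \<in> homogeneous e \<Longrightarrow> P * Q \<in> homogeneous (d + e)"
  using keys_mult[of P Q] by (fastforce simp: homogeneous_def total_deg_add)

lemma homogeneous_smult: "P \<in> homogeneous d \<Longrightarrow> smult_mpoly a P \<in> homogeneous d"
  by (auto simp: homogeneous_def in_keys_iff)

lemma homogeneous_diff: "P \<in> homogeneous d \<Longrightarrow> Q \<in> homogeneous d \<Longrightarrow> P - Q \<in> homogeneous d"
  using homogeneous_add[OF _ homogeneous_smult[of Q d "-1"], of P]
  by (smt (verit) homogeneous_def in_keys_iff lookup_minus mem_Collect_eq)

lemma homogeneous_linear_form: "linear_form u \<in> homogeneous 1"
  unfolding linear_form_def by (intro homogeneous_sum homogeneous_single) simp

lemma homogeneous_power: "P \<in> homogeneous d \<Longrightarrow> P ^ k \<in> homogeneous (k * d)"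
proof (induction k)
  case 0
  then show ?case by (simp add: homogeneous_def total_deg_def)
next
  case (Suc k)
  then show ?case using homogeneous_mult[of P d "P ^ k" "k * d"] by simp
qed

section \<open>Evaluation as a ring homomorphism\<close>

lemma monom_eval_add: "monom_eval (\<alpha> + \<beta>) x = monom_eval \<alpha> x * monom_eval \<beta> x"
  by (simp add: monom_eval_def lookup_add power_add prod.distrib)

lemma monom_eval_0 [simp]: "monom_eval 0 x = 1"
  by (simp add: monom_eval_def)

lemma monom_eval_single [simp]: "monom_eval (Poly_Mapping.single i k) x = (x $ i) ^ k"
  by (simp add: monom_eval_def lookup_single when_def if_distrib[of "\<lambda>n. _ ^ n"] cong: if_cong)

lemma monom_eval_scale: "monom_eval \<alpha> (a *\<^sub>R x) = a ^ total_deg \<alpha> * monom_eval \<alpha> x"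
  by (simp add: monom_eval_def power_mult_distrib prod.distrib total_deg_def power_sum)

text \<open>The keys change under addition; a common finite index set makes the sums for
  \<open>P\<close>, \<open>Q\<close> and \<open>P + Q\<close> comparable.\<close>

lemma peval_superset:
  assumes "finite S" "Poly_Mapping.keys P \<subseteq> S"
  shows "peval P x = (\<Sum>\<alpha>\<in>S. Poly_Mapping.lookup P \<alpha> * monom_eval \<alpha> x)"
  unfolding peval_def monom_eval_def
  by (intro sum.mono_neutral_left assms) (auto simp: in_keys_iff)

lemma peval_0 [simp]: "peval 0 x = 0"
  by (simp add: peval_def)

lemma peval_single [simp]: "peval (Poly_Mapping.single \<alpha> a) x = a * monom_eval \<alpha> x"
  by (subst peval_superset[of "{\<alpha>}"]) auto

lemma peval_add [simp]: "peval (P + Q) x = peval P x + peval Q x"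
proof -
  let ?S = "Poly_Mapping.keys P \<union> Poly_Mapping.keys Q"
  have "peval T x = (\<Sum>\<alpha>\<in>?S. Poly_Mapping.lookup T \<alpha> * monom_eval \<alpha> x)" if "T \<in> {P, Q, P + Q}" for T
    using that keys_add[of P Q] by (intro peval_superset) auto
  then show ?thesis by (simp add: lookup_add algebra_simps sum.distrib)
qed

lemma peval_smult [simp]: "peval (smult_mpoly a P) x = a * peval P x"
  by (subst peval_superset[of "Poly_Mapping.keys P"])
    (auto simp: in_keys_iff peval_def monom_eval_def sum_distrib_left mult.assoc)

lemma mpoly_diff_eq: "P - Q = P + smult_mpoly (-1) Q"
  by (rule poly_mapping_eqI) (simp add: lookup_add lookup_minus)

lemma peval_diff [simp]: "peval (P - Q) x = peval P x - peval Q x"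
  by (simp add: mpoly_diff_eq)

lemma peval_sum: "peval (\<Sum>i\<in>I. P i) x = (\<Sum>i\<in>I. peval (P i) x)"
  by (induction I rule: infinite_finite_induct) auto

lemma peval_mult [simp]: "peval (P * Q) x = peval P x * peval Q x"
proof (induction P rule: mpoly_induct)
  case (monom \<alpha> a)
  show ?case
    by (induction Q rule: mpoly_induct)
      (auto simp: mult_single monom_eval_add algebra_simps)
qed (auto simp: algebra_simps)

lemma peval_1 [simp]: "peval 1 x = 1"
  using peval_single[of 0 1] by simp

lemma peval_power [simp]: "peval (P ^ k) x = peval P x ^ k"
  by (induction k) auto

lemma peval_linear_form [simp]: "peval (linear_form u) x = u \<bullet> x"
  by (simp add: linear_form_def peval_sum inner_vec_def)

lemma peval_scale:
  assumes "P \<in> homogeneous d"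
  shows "peval P (a *\<^sub>R x) = a ^ d * peval P x"
  using assms by (induction P rule: homogeneous_induct) (auto simp: monom_eval_scale algebra_simps)

section \<open>Formal partial derivatives and the gradient\<close>

lemma partial_deriv_superset:
  assumes "finite S" "Poly_Mapping.keys P \<subseteq> S"
  shows "partial_deriv i P = (\<Sum>\<alpha>\<in>S. Poly_Mapping.single (\<alpha> - Poly_Mapping.single i 1)
     (real (Poly_Mapping.lookup \<alpha> i) * Poly_Mapping.lookup P \<alpha>))"
  unfolding partial_deriv_def
  by (intro sum.mono_neutral_left assms) (auto simp: in_keys_iff)

lemma partial_deriv_0 [simp]: "partial_deriv i 0 = 0"
  by (simp add: partial_deriv_def)

lemma partial_deriv_single: "partial_deriv i (Poly_Mapping.single \<alpha> a)
    = Poly_Mapping.single (\<alpha> - Poly_Mapping.single i 1) (real (Poly_Mapping.lookup \<alpha> i) * a)"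
  by (subst partial_deriv_superset[of "{\<alpha>}"]) auto

lemma partial_deriv_add [simp]: "partial_deriv i (P + Q) = partial_deriv i P + partial_deriv i Q"
proof -
  let ?S = "Poly_Mapping.keys P \<union> Poly_Mapping.keys Q"
  have "partial_deriv i T = (\<Sum>\<alpha>\<in>?S. Poly_Mapping.single (\<alpha> - Poly_Mapping.single i 1)
     (real (Poly_Mapping.lookup \<alpha> i) * Poly_Mapping.lookup T \<alpha>))" if "T \<in> {P, Q, P + Q}" for T
    using that keys_add[of P Q] by (intro partial_deriv_superset) auto
  then show ?thesis by (simp add: lookup_add algebra_simps sum.distrib single_add)
qed

lemma exponent_diff_add:
  fixes \<alpha> :: "'n exponent"
  assumes "Poly_Mapping.lookup \<alpha> i \<noteq> 0"
  shows "\<alpha> - Poly_Mapping.single i 1 + Poly_Mapping.single i 1 = \<alpha>"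
  using assms by (intro poly_mapping_eqI) (auto simp: lookup_add lookup_minus lookup_single when_def)

lemma homogeneous_partial_deriv:
  assumes "P \<in> homogeneous (Suc d)"
  shows "partial_deriv i P \<in> homogeneous d"
  using assms
proof (induction P rule: homogeneous_induct)
  case (monom \<alpha> a)
  show ?case
  proof (cases "Poly_Mapping.lookup \<alpha> i = 0")
    case False
    from exponent_diff_add[OF this] monom show ?thesis
      by (metis homogeneous_single partial_deriv_single add_right_cancel Suc_eq_plus1 total_deg_add
          total_deg_single)
  qed (simp add: partial_deriv_single)
qed (auto intro: homogeneous_add)

lemma monom_eval_Diff:
  "(x $ i) ^ Poly_Mapping.lookup \<alpha> i * (\<Prod>j\<in>UNIV - {i}. (x $ j) ^ Poly_Mapping.lookup \<alpha> j) = monom_eval \<alpha> x"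
  unfolding monom_eval_def by (subst prod.remove[of UNIV i]) auto

text \<open>At exponent 0 both sides truncate in the same way. The right-hand side has the shape
  that the product rule delivers.\<close>

lemma monom_eval_minus_single:
  "monom_eval (\<alpha> - Poly_Mapping.single i 1) x
   = (x $ i) ^ (Poly_Mapping.lookup \<alpha> i - 1) * (\<Prod>j\<in>UNIV - {i}. (x $ j) ^ Poly_Mapping.lookup \<alpha> j)"
  by (subst monom_eval_Diff[symmetric, of _ x i])
    (auto simp: lookup_minus lookup_single when_def intro!: prod.cong)

lemma has_derivative_monom_eval:
  "(monom_eval \<alpha> has_derivative
     (\<lambda>h. \<Sum>i\<in>UNIV. h $ i * (real (Poly_Mapping.lookup \<alpha> i) * monom_eval (\<alpha> - Poly_Mapping.single i 1) x)))
   (at x)"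
proof -
  have "((\<lambda>x. (x $ i) ^ k) has_derivative
          (\<lambda>h. of_nat k * h $ i * (x $ i) ^ (k - 1))) (at x)" for i :: 'a and k
    by (intro has_derivative_power bounded_linear_imp_has_derivative bounded_linear_vec_nth)
  from has_derivative_prod[OF this, of "\<lambda>i. i" "Poly_Mapping.lookup \<alpha>" UNIV]
  have "((\<lambda>x. \<Prod>i\<in>UNIV. (x $ i) ^ Poly_Mapping.lookup \<alpha> i) has_derivative
     (\<lambda>h. \<Sum>i\<in>UNIV. h $ i * (real (Poly_Mapping.lookup \<alpha> i) * monom_eval (\<alpha> - Poly_Mapping.single i 1) x)))
     (at x)"
    unfolding monom_eval_minus_single by (simp only: mult_ac)
  moreover have "(\<lambda>x. \<Prod>i\<in>UNIV. (x $ i) ^ Poly_Mapping.lookup \<alpha> i) = monom_eval \<alpha>"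
    by (rule ext) (simp only: monom_eval_def)
  ultimately show ?thesis by simp
qed

lemma has_derivative_peval:
  "(peval P has_derivative (\<lambda>h. \<Sum>i\<in>UNIV. h $ i * peval (partial_deriv i P) x)) (at x)"
proof (induction P rule: mpoly_induct)
  case zero
  then show ?case by (simp add: peval_def[abs_def])
next
  case (monom \<alpha> a)
  have "((\<lambda>x. a * monom_eval \<alpha> x) has_derivative
     (\<lambda>h. a * (\<Sum>i\<in>UNIV. h $ i * (real (Poly_Mapping.lookup \<alpha> i) * monom_eval (\<alpha> - Poly_Mapping.single i 1) x))))
   (at x)"
    by (intro has_derivative_mult_right has_derivative_monom_eval)
  then show ?case
    by (simp add: partial_deriv_single sum_distrib_left mult_ac flip: peval_single[abs_def])
next
  case (add P Q)
  from has_derivative_add[OF this] show ?case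
    by (simp add: sum.distrib algebra_simps flip: peval_add[abs_def])
qed

lemma grad_unique: "GDERIV (peval P) x :> D \<Longrightarrow> grad P x = D"
  using has_derivative_unique[OF GDERIV_grad[of P x, unfolded gderiv_def], of "\<lambda>h. h \<bullet> D"]
  unfolding gderiv_def by (metis vector_eq_ldot)

text \<open>Uniqueness of the derivative ties the analytic gradient to formal derivatives; linearity
  and scaling of the gradient then become facts about evaluation.\<close>

lemma grad_nth [simp]: "grad P x $ i = peval (partial_deriv i P) x"
proof -
  have "grad P x = (\<chi> i. peval (partial_deriv i P) x)"
    by (rule grad_unique) (use has_derivative_peval[of P x] in \<open>simp add: gderiv_def inner_vec_def\<close>)
  then show ?thesis by simp
qed

lemma grad_add: "grad (P + Q) x = grad P x + grad Q x"
  by (simp add: vec_eq_iff)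

lemma partial_deriv_smult [simp]: "partial_deriv i (smult_mpoly a P) = smult_mpoly a (partial_deriv i P)"
proof (induction P rule: mpoly_induct)
  case (monom \<alpha> b)
  then show ?case by (simp add: smult_mpoly_eq mult_single partial_deriv_single mult_ac)
qed (simp_all add: smult_mpoly_eq algebra_simps)

lemma grad_smult: "grad (smult_mpoly a P) x = a *\<^sub>R grad P x"
  by (simp add: vec_eq_iff)

lemma grad_diff: "grad (P - Q) x = grad P x - grad Q x"
  by (simp add: mpoly_diff_eq grad_add grad_smult)

lemma grad_scale:
  assumes "P \<in> homogeneous d" "d > 0"
  shows "grad P (a *\<^sub>R x) = a ^ (d - 1) *\<^sub>R grad P x"
proof -
  have "partial_deriv i P \<in> homogeneous (d - 1)" for i
    using assms by (intro homogeneous_partial_deriv) simp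
  then show ?thesis by (simp add: vec_eq_iff peval_scale)
qed

text \<open>Euler's identity. On a monomial, \<open>x $ i\<close> times the i-th derivative is the
  monomial times its i-th exponent, and the exponents add up to \<open>d\<close>.\<close>

lemma inner_grad:
  assumes "P \<in> homogeneous d"
  shows "x \<bullet> grad P x = real d * peval P x"
  using assms
proof (induction P rule: homogeneous_induct)
  case (monom \<alpha> a)
  have "x $ i * (real (Poly_Mapping.lookup \<alpha> i) * monom_eval (\<alpha> - Poly_Mapping.single i 1) x)
      = real (Poly_Mapping.lookup \<alpha> i) * monom_eval \<alpha> x" for i
    using monom_eval_minus_single[of \<alpha> i x]
    by (cases "Poly_Mapping.lookup \<alpha> i") (simp_all add: mult_ac flip: monom_eval_Diff[of x i \<alpha>])
  then have "(\<Sum>i\<in>UNIV. x $ i * (real (Poly_Mapping.lookup \<alpha> i) * monom_eval (\<alpha> - Poly_Mapping.single i 1) x))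
      = real (total_deg \<alpha>) * monom_eval \<alpha> x"
    by (simp only: total_deg_def sum_distrib_right of_nat_sum)
  then show ?case using monom
    by (simp add: inner_vec_def partial_deriv_single mult_ac flip: sum_distrib_left)
qed (simp_all add: inner_vec_def algebra_simps sum.distrib)

lemma peval_continuous [continuous_intros]:
  "continuous_on S f \<Longrightarrow> continuous_on S (\<lambda>x. peval P (f x))"
  using has_derivative_continuous[OF has_derivative_peval]
  by (intro continuous_on_compose2[of UNIV "peval P" S f]) (auto intro: continuous_at_imp_continuous_on)

lemma grad_continuous [continuous_intros]:
  assumes "continuous_on S f"
  shows "continuous_on S (\<lambda>x. grad P (f x))"
proof -
  have eq: "(\<lambda>x. grad P (f x)) = (\<lambda>x. \<chi> i. peval (partial_deriv i P) (f x))"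
    by (intro ext) (simp add: vec_eq_iff)
  show ?thesis
    unfolding eq by (intro continuous_on_vec_lambda peval_continuous assms)
qed

lemma peval_differentiable: "peval P differentiable (at x within S)"
  unfolding differentiable_def by (blast intro: has_derivative_at_withinI has_derivative_peval)

text \<open>Needed to see that the image of a hyperplane under a map built from the gradient is a
  null set.\<close>

lemma grad_differentiable: "grad P differentiable_on S"
proof -
  have "(\<lambda>x. grad P x \<bullet> b) differentiable at x within S" if "b \<in> Basis" for b x
  proof -
    from that obtain i where "b = axis i 1" by (auto simp: Basis_vec_def)
    then have "(\<lambda>x. grad P x \<bullet> b) = peval (partial_deriv i P)" by (simp add: inner_axis fun_eq_iff)
    then show ?thesis by (simp add: peval_differentiable)
  qed
  then show ?thesis
    unfolding differentiable_on_def by (metis differentiable_componentwise_within)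
qed

subsection \<open>The Bombieri scalar product\<close>

lemma weight_pos: "weight \<alpha> > 0"
  by (simp add: weight_def mfact_def prod_pos)

lemma bombieri_inner_superset:
  assumes "finite S" "Poly_Mapping.keys P \<subseteq> S" "Poly_Mapping.keys Q \<subseteq> S"
  shows "bombieri_inner P Q = (\<Sum>\<alpha>\<in>S. weight \<alpha> * Poly_Mapping.lookup P \<alpha> * Poly_Mapping.lookup Q \<alpha>)"
  unfolding bombieri_inner_def weight_def
  using assms by (intro sum.mono_neutral_left) (auto simp: in_keys_iff)

lemma bombieri_inner_commute: "bombieri_inner P Q = bombieri_inner Q P"
  by (simp add: bombieri_inner_def Un_commute mult_ac)

lemma bombieri_inner_add_left: "bombieri_inner (P + Q) T = bombieri_inner P T + bombieri_inner Q T"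
proof -
  let ?S = "Poly_Mapping.keys P \<union> Poly_Mapping.keys Q \<union> Poly_Mapping.keys T"
  have "bombieri_inner U T = (\<Sum>\<alpha>\<in>?S. weight \<alpha> * Poly_Mapping.lookup U \<alpha> * Poly_Mapping.lookup T \<alpha>)"
    if "U \<in> {P, Q, P + Q}" for U
    using that keys_add[of P Q] by (intro bombieri_inner_superset) auto
  then show ?thesis by (simp add: lookup_add algebra_simps sum.distrib)
qed

lemma bombieri_inner_smult_left: "bombieri_inner (smult_mpoly a P) Q = a * bombieri_inner P Q"
proof -
  let ?S = "Poly_Mapping.keys P \<union> Poly_Mapping.keys Q"
  have "bombieri_inner U Q = (\<Sum>\<alpha>\<in>?S. weight \<alpha> * Poly_Mapping.lookup U \<alpha> * Poly_Mapping.lookup Q \<alpha>)"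
    if "U \<in> {P, smult_mpoly a P}" for U
    using that by (intro bombieri_inner_superset) (auto simp: in_keys_iff)
  then show ?thesis by (simp add: sum_distrib_left mult_ac)
qed

lemma bombieri_inner_diff_left: "bombieri_inner (P - Q) T = bombieri_inner P T - bombieri_inner Q T"
  by (simp add: mpoly_diff_eq bombieri_inner_add_left bombieri_inner_smult_left)

lemma bombieri_inner_add_right: "bombieri_inner T (P + Q) = bombieri_inner T P + bombieri_inner T Q"
  by (metis bombieri_inner_add_left bombieri_inner_commute)

lemma bombieri_inner_smult_right: "bombieri_inner P (smult_mpoly a Q) = a * bombieri_inner P Q"
  by (metis bombieri_inner_smult_left bombieri_inner_commute)

lemma bombieri_inner_diff_right: "bombieri_inner T (P - Q) = bombieri_inner T P - bombieri_inner T Q"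
  by (metis bombieri_inner_diff_left bombieri_inner_commute)

lemmas bombieri_inner_simps =
  bombieri_inner_add_left bombieri_inner_smult_left bombieri_inner_diff_left
  bombieri_inner_add_right bombieri_inner_smult_right bombieri_inner_diff_right

lemma bombieri_inner_0 [simp]: "bombieri_inner 0 P = 0" "bombieri_inner P 0 = 0"
  by (simp_all add: bombieri_inner_def)

lemma bombieri_inner_sum_right:
  "bombieri_inner Q (\<Sum>i\<in>I. P i) = (\<Sum>i\<in>I. bombieri_inner Q (P i))"
  by (induction I rule: infinite_finite_induct) (auto simp: bombieri_inner_simps)

lemma bombieri_inner_single_right:
  "bombieri_inner P (Poly_Mapping.single \<alpha> a) = weight \<alpha> * Poly_Mapping.lookup P \<alpha> * a"
  by (subst bombieri_inner_superset[of "insert \<alpha> (Poly_Mapping.keys P)"])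
    (auto simp: lookup_single when_def if_distrib cong: if_cong)

lemma bombieri_inner_self:
  "bombieri_inner P P = (\<Sum>\<alpha>\<in>Poly_Mapping.keys P. weight \<alpha> * (Poly_Mapping.lookup P \<alpha>)\<^sup>2)"
  by (simp add: bombieri_inner_def weight_def power2_eq_square mult.assoc)

lemma bombieri_inner_nonneg [simp]: "bombieri_inner P P \<ge> 0"
  by (simp add: bombieri_inner_self sum_nonneg less_imp_le[OF weight_pos])

lemma bombieri_inner_eq_0_iff: "bombieri_inner P P = 0 \<longleftrightarrow> P = 0"
proof
  assume "bombieri_inner P P = 0"
  then have "\<forall>\<alpha>\<in>Poly_Mapping.keys P. weight \<alpha> * (Poly_Mapping.lookup P \<alpha>)\<^sup>2 = 0"
    unfolding bombieri_inner_self
    by (subst (asm) sum_nonneg_eq_0_iff) (simp_all add: less_imp_le[OF weight_pos])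
  then have "Poly_Mapping.lookup P \<alpha> = 0" for \<alpha>
    using weight_pos[of \<alpha>] by (cases "\<alpha> \<in> Poly_Mapping.keys P") (auto simp: in_keys_iff)
  then show "P = 0" by (intro poly_mapping_eqI) simp
qed simp

lemma bombieri_norm_nonneg [simp]: "bombieri_norm P \<ge> 0"
  by (simp add: bombieri_norm_def)

lemma bombieri_norm_power2 [simp]: "(bombieri_norm P)\<^sup>2 = bombieri_inner P P"
  by (simp add: bombieri_norm_def)

lemma bombieri_norm_smult: "bombieri_norm (smult_mpoly a P) = \<bar>a\<bar> * bombieri_norm P"
  by (simp add: bombieri_norm_def bombieri_inner_simps real_sqrt_mult flip: mult.assoc)

lemma bombieri_norm_minus_commute: "bombieri_norm (P - Q) = bombieri_norm (Q - P)"
  by (simp add: bombieri_norm_def bombieri_inner_simps bombieri_inner_commute)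

text \<open>Scaling each coefficient by the root of its weight turns the Bombieri norm into a
  Euclidean norm on a common finite index set.\<close>

lemma bombieri_norm_triangle: "bombieri_norm (P + Q) \<le> bombieri_norm P + bombieri_norm Q"
proof -
  let ?S = "Poly_Mapping.keys P \<union> Poly_Mapping.keys Q"
  have "bombieri_norm T = L2_set (\<lambda>\<alpha>. sqrt (weight \<alpha>) * Poly_Mapping.lookup T \<alpha>) ?S"
    if "T \<in> {P, Q, P + Q}" for T
    using that keys_add[of P Q] unfolding bombieri_norm_def L2_set_def
    by (subst bombieri_inner_superset[of ?S])
      (auto simp: power_mult_distrib less_imp_le[OF weight_pos] mult.assoc simp flip: power2_eq_square)
  then show ?thesis
    using L2_set_triangle_ineq[of "\<lambda>\<alpha>. sqrt (weight \<alpha>) * Poly_Mapping.lookup P \<alpha>"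
        "\<lambda>\<alpha>. sqrt (weight \<alpha>) * Poly_Mapping.lookup Q \<alpha>" ?S]
    by (simp add: lookup_add distrib_left)
qed

text \<open>Raising the i-th exponent multiplies \<beta>! by the new exponent and the factorial of
  the degree by the new degree. This ratio makes differentiation adjoint to multiplication by a
  variable.\<close>

lemma weight_add_single:
  "real (Suc (total_deg \<beta>)) * weight (\<beta> + Poly_Mapping.single i 1)
    = real (Suc (Poly_Mapping.lookup \<beta> i)) * weight \<beta>"
proof -
  have "mfact (\<beta> + Poly_Mapping.single i 1) = Suc (Poly_Mapping.lookup \<beta> i) * mfact \<beta>"
    unfolding mfact_def
    by (subst (1 2) prod.remove[of UNIV i])
      (auto simp: lookup_add lookup_single when_def algebra_simps intro!: prod.cong)
  then show ?thesis by (simp add: weight_def total_deg_add del: of_nat_Suc mult_Suc)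
qed

text \<open>Adjointness: by linearity \<open>Q\<close> may be a monomial, and then only one
  coefficient of \<open>P\<close> enters on each side.\<close>

lemma bombieri_inner_variable_mult:
  assumes "Q \<in> homogeneous d"
  shows "real (Suc d) * bombieri_inner P (Poly_Mapping.single (Poly_Mapping.single i 1) a * Q)
    = a * bombieri_inner (partial_deriv i P) Q"
  using assms
proof (induction Q rule: homogeneous_induct)
  case (monom \<beta> b)
  have lookup_partial: "Poly_Mapping.lookup (partial_deriv i P) \<beta> = real (Suc (Poly_Mapping.lookup \<beta> i)) *
      Poly_Mapping.lookup P (\<beta> + Poly_Mapping.single i 1)"
  proof (induction P rule: mpoly_induct)
    case (monom \<alpha> c)
    show ?case
    proof (cases "\<alpha> = \<beta> + Poly_Mapping.single i 1")
      case True
      then show ?thesis by (simp add: partial_deriv_single lookup_add)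
    next
      \<comment> \<open>An exponent with i-th entry 0 is fixed by the truncated subtraction and may
        equal \<beta>, but its derivative has coefficient 0.\<close>
      case False
      then have "\<alpha> - Poly_Mapping.single i 1 \<noteq> \<beta>" if "Poly_Mapping.lookup \<alpha> i \<noteq> 0"
        using exponent_diff_add[OF that] by metis
      with False show ?thesis
        by (cases "Poly_Mapping.lookup \<alpha> i = 0") (auto simp: partial_deriv_single lookup_single when_def)
    qed
  qed (auto simp: lookup_add algebra_simps)
  have "real (Suc d) * bombieri_inner P (Poly_Mapping.single (Poly_Mapping.single i 1) a * Poly_Mapping.single \<beta> b)
    = (real (Suc d) * weight (\<beta> + Poly_Mapping.single i 1)) * (Poly_Mapping.lookup P (\<beta> + Poly_Mapping.single i 1) * (a * b))"
    by (simp only: mult_single bombieri_inner_single_right add.commute mult.assoc)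
  also have "\<dots> = a * bombieri_inner (partial_deriv i P) (Poly_Mapping.single \<beta> b)"
    using weight_add_single[of \<beta> i] monom
    by (simp only: bombieri_inner_single_right lookup_partial mult_ac)
  finally show ?case .
qed (simp_all add: bombieri_inner_simps algebra_simps)

lemma bombieri_inner_linear_form_mult:
  assumes "Q \<in> homogeneous d"
  shows "real (Suc d) * bombieri_inner P (linear_form u * Q)
    = (\<Sum>i\<in>UNIV. u $ i * bombieri_inner (partial_deriv i P) Q)"
  unfolding linear_form_def sum_distrib_right bombieri_inner_sum_right sum_distrib_left
    bombieri_inner_variable_mult[OF assms] ..

text \<open>Reproducing property of the powers \<langle>x, X\<rangle>^d. Adjointness moves one
  linear factor onto \<open>P\<close> as a derivative, induction evaluates the partial derivatives
  at \<open>x\<close>, and Euler's identity reassembles \<open>P\<close>.\<close>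

lemma bombieri_inner_power:
  assumes "P \<in> homogeneous d"
  shows "bombieri_inner P (linear_form x ^ d) = peval P x"
  using assms
proof (induction d arbitrary: P)
  case 0
  have "Poly_Mapping.keys P \<subseteq> {0}"
    using 0 by (auto simp: homogeneous_def total_deg_eq_0_iff)
  then have "peval P x = Poly_Mapping.lookup P 0"
    by (subst peval_superset[of "{0}"]) auto
  with bombieri_inner_single_right[of P 0 1] show ?case
    by (simp add: weight_def mfact_def total_deg_def)
next
  case (Suc d)
  have "linear_form x ^ d \<in> homogeneous d"
    using homogeneous_power[OF homogeneous_linear_form, of x d] by simp
  then have "real (Suc d) * bombieri_inner P (linear_form x ^ Suc d)
     = (\<Sum>i\<in>UNIV. x $ i * bombieri_inner (partial_deriv i P) (linear_form x ^ d))"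
    unfolding power_Suc by (rule bombieri_inner_linear_form_mult)
  also have "\<dots> = x \<bullet> grad P x"
    using Suc by (simp add: homogeneous_partial_deriv inner_vec_def)
  also have "\<dots> = real (Suc d) * peval P x"
    by (rule inner_grad) fact
  finally show ?case by (simp del: of_nat_Suc power_Suc)
qed

text \<open>
  For \<open>norm x = 1\<close> these polynomials span the orthogonal complement of \<open>disc_at d x\<close>.
\<close>

definition tangent_poly :: "nat \<Rightarrow> real ^ 'n \<Rightarrow> real ^ 'n \<Rightarrow> 'n::finite mpoly" where
  "tangent_poly d u x = linear_form u * linear_form x ^ (d - 1)"

lemma homogeneous_tangent_poly:
  assumes "d > 0"
  shows "tangent_poly d u x \<in> homogeneous d"
  using homogeneous_mult[OF homogeneous_linear_form homogeneous_power[OF homogeneous_linear_form],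
      of u x "d - 1"] assms
  by (simp add: tangent_poly_def)

text \<open>One use of adjointness turns the factor \<open>linear_form u\<close> into a directional
  derivative; the remaining power evaluates it at \<open>x\<close>.\<close>

lemma bombieri_inner_tangent_poly:
  assumes "P \<in> homogeneous d" "d > 0"
  shows "bombieri_inner P (tangent_poly d u x) = (u \<bullet> grad P x) / real d"
proof -
  obtain e where d: "d = Suc e" using assms(2) by (cases d) auto
  have "linear_form x ^ e \<in> homogeneous e"
    using homogeneous_power[OF homogeneous_linear_form, of x e] by simp
  then have "real d * bombieri_inner P (tangent_poly d u x)
     = (\<Sum>i\<in>UNIV. u $ i * bombieri_inner (partial_deriv i P) (linear_form x ^ e))"
    unfolding d tangent_poly_def by (simp del: of_nat_Suc add: bombieri_inner_linear_form_mult)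
  also have "\<dots> = u \<bullet> grad P x"
    using assms unfolding d by (simp add: homogeneous_partial_deriv inner_vec_def bombieri_inner_power)
  finally show ?thesis using assms(2) by (simp add: field_simps)
qed

lemma peval_tangent_poly [simp]: "peval (tangent_poly d u x) y = (u \<bullet> y) * (x \<bullet> y) ^ (d - 1)"
  by (simp add: tangent_poly_def)

text \<open>When \<open>d - 2\<close> truncates for \<open>d = 1\<close>, the factor
  \<open>real (d - 1)\<close> vanishes.\<close>

lemma grad_tangent_poly:
  "grad (tangent_poly d u x) y
    = (x \<bullet> y) ^ (d - 1) *\<^sub>R u + (real (d - 1) * (u \<bullet> y) * (x \<bullet> y) ^ (d - 2)) *\<^sub>R x"
proof (rule grad_unique)
  have "peval (tangent_poly d u x) = (\<lambda>y. (u \<bullet> y) * (x \<bullet> y) ^ (d - 1))"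
    by (rule ext) simp
  moreover have "((\<lambda>y. (u \<bullet> y) * (x \<bullet> y) ^ (d - 1)) has_derivative
     (\<lambda>h. h \<bullet> ((x \<bullet> y) ^ (d - 1) *\<^sub>R u + (real (d - 1) * (u \<bullet> y) * (x \<bullet> y) ^ (d - 2)) *\<^sub>R x))) (at y)"
    by (auto intro!: derivative_eq_intros simp: algebra_simps inner_commute numeral_2_eq_2)
  ultimately show "GDERIV (peval (tangent_poly d u x)) y :>
     (x \<bullet> y) ^ (d - 1) *\<^sub>R u + (real (d - 1) * (u \<bullet> y) * (x \<bullet> y) ^ (d - 2)) *\<^sub>R x"
    by (simp add: gderiv_def)
qed

subsection \<open>Distance to the discriminant\<close>

definition disc_form :: "nat \<Rightarrow> 'n::finite mpoly \<Rightarrow> 'n mpoly \<Rightarrow> real ^ 'n \<Rightarrow> real" where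
  "disc_form d P Q x = peval P x * peval Q x + (tgrad P x \<bullet> tgrad Q x) / real d"

text \<open>
  \<open>P - disc_proj d P x\<close> is the orthogonal projection of \<open>P\<close> on \<open>disc_at d x\<close>, and \<open>disc_form d P Q x\<close>
  is the scalar product of the components of \<open>P\<close> and \<open>Q\<close> orthogonal to \<open>disc_at d x\<close>.
\<close>

definition disc_proj :: "nat \<Rightarrow> 'n::finite mpoly \<Rightarrow> real ^ 'n \<Rightarrow> 'n mpoly" where
  "disc_proj d P x = tangent_poly d (peval P x *\<^sub>R x + tgrad P x) x"

lemma tgrad_linear:
  "tgrad (P + Q) x = tgrad P x + tgrad Q x"
  "tgrad (P - Q) x = tgrad P x - tgrad Q x"
  "tgrad (smult_mpoly a P) x = a *\<^sub>R tgrad P x"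
  by (simp_all add: tgrad_def grad_add grad_diff grad_smult algebra_simps)

lemma disc_form_linear:
  "disc_form d (P + Q) T x = disc_form d P T x + disc_form d Q T x"
  "disc_form d (P - Q) T x = disc_form d P T x - disc_form d Q T x"
  "disc_form d (smult_mpoly a P) T x = a * disc_form d P T x"
  "disc_form d T (P + Q) x = disc_form d T P x + disc_form d T Q x"
  "disc_form d T (P - Q) x = disc_form d T P x - disc_form d T Q x"
  "disc_form d T (smult_mpoly a P) x = a * disc_form d T P x"
  by (simp_all add: disc_form_def tgrad_linear algebra_simps inner_simps add_divide_distrib diff_divide_distrib)

lemma disc_form_commute: "disc_form d P Q x = disc_form d Q P x"
  by (simp add: disc_form_def inner_commute mult.commute)

lemma disc_form_nonneg: "disc_form d P P x \<ge> 0"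
  by (simp add: disc_form_def)

lemma disc_form_self: "disc_form d P P x = (peval P x)\<^sup>2 + (norm (tgrad P x))\<^sup>2 / real d"
  by (simp add: disc_form_def power2_eq_square dot_square_norm)

lemma continuous_on_disc_form: "continuous_on S (disc_form d P Q)"
proof -
  have eq: "disc_form d P Q = (\<lambda>x. peval P x * peval Q x +
      ((grad P x - (x \<bullet> grad P x) *\<^sub>R x) \<bullet> (grad Q x - (x \<bullet> grad Q x) *\<^sub>R x)) * (1 / real d))"
    by (simp add: fun_eq_iff disc_form_def tgrad_def)
  show ?thesis unfolding eq by (intro continuous_intros)
qed

lemma inner_tgrad [simp]: "norm x = 1 \<Longrightarrow> x \<bullet> tgrad P x = 0"
  by (simp add: tgrad_def inner_simps dot_square_norm)

text \<open>By Euler's identity the radial part of the gradient is governed by the value of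
  \<open>P\<close>, so value and tangential gradient together detect singularity.\<close>

lemma disc_form_eq_0_iff:
  assumes "P \<in> homogeneous d" "d > 0"
  shows "disc_form d P P x = 0 \<longleftrightarrow> grad P x = 0"
proof
  assume "disc_form d P P x = 0"
  then have "peval P x = 0 \<and> tgrad P x = 0"
    unfolding disc_form_self using assms(2)
    by (subst (asm) add_nonneg_eq_0_iff) auto
  then show "grad P x = 0"
    using inner_grad[OF assms(1), of x] by (simp add: tgrad_def)
next
  assume "grad P x = 0"
  then show "disc_form d P P x = 0"
    using inner_grad[OF assms(1), of x] assms(2) by (simp add: disc_form_def tgrad_def)
qed

lemma homogeneous_disc_proj: "d > 0 \<Longrightarrow> disc_proj d P x \<in> homogeneous d"
  unfolding disc_proj_def by (rule homogeneous_tangent_poly)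

text \<open>The tangential part of \<open>P\<close> sees only the tangential gradient of
  \<open>Q\<close>; in the radial part the factor \<open>d\<close> from Euler's identity cancels the
  denominator.\<close>

lemma bombieri_inner_disc_proj:
  assumes "Q \<in> homogeneous d" "d > 0" "norm x = 1"
  shows "bombieri_inner Q (disc_proj d P x) = disc_form d P Q x"
proof -
  have "tgrad P x \<bullet> grad Q x = tgrad P x \<bullet> tgrad Q x"
    using assms(3) by (simp add: tgrad_def[of Q] inner_simps inner_commute[of "tgrad P x" x])
  then show ?thesis
    using assms inner_grad[OF assms(1), of x]
    by (simp add: disc_proj_def bombieri_inner_tangent_poly disc_form_def inner_simps field_simps)
qed

lemma diff_disc_proj_in_disc_at:
  assumes "P \<in> homogeneous d" "d > 1" "norm x = 1"
  shows "P - disc_proj d P x \<in> disc_at d x"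
proof -
  have xx: "x \<bullet> x = 1" using assms(3) by (simp add: dot_square_norm)
  have "tgrad P x \<bullet> x = 0" using assms(3) by (simp add: inner_commute)
  then have w: "(peval P x *\<^sub>R x + tgrad P x) \<bullet> x = peval P x"
    by (simp add: inner_simps xx)
  \<comment> \<open>At a unit vector the gradient of \<open>tangent_poly d u x\<close> is u +
    (d-1)\<langle>u, x\<rangle>x, so the radial coefficient P(x) becomes d P(x), as Euler's identity
    demands.\<close>
  have "grad (disc_proj d P x) x = (real d * peval P x) *\<^sub>R x + tgrad P x"
    unfolding disc_proj_def grad_tangent_poly w xx
    using assms(2) by (simp add: of_nat_diff algebra_simps)
  also have "\<dots> = grad P x"
    by (simp add: tgrad_def flip: inner_grad[OF assms(1)])
  finally have "grad (P - disc_proj d P x) x = 0"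
    by (simp add: grad_diff)
  moreover have "peval (P - disc_proj d P x) x = 0"
    by (simp add: disc_proj_def w xx)
  ultimately show ?thesis
    using assms by (simp add: disc_at_def homogeneous_diff homogeneous_disc_proj)
qed

lemma disc_form_disc_at: "T \<in> disc_at d x \<Longrightarrow> disc_form d P T x = 0"
  by (simp add: disc_at_def disc_form_def tgrad_def)

text \<open>Split P - Q = E + T with E the projection term and T in \<open>disc_at d x\<close>.
  Pairing with E is \<open>disc_form d P\<close>, which kills everything singular at
  \<open>x\<close>; this gives both orthogonality and the squared norm of E.\<close>

lemma disc_at_pythagoras:
  assumes "P \<in> homogeneous d" "d > 1" "norm x = 1" "Q \<in> disc_at d x"
  shows "bombieri_inner (P - Q) (P - Q) = disc_form d P P x
    + bombieri_inner (P - disc_proj d P x - Q) (P - disc_proj d P x - Q)"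
proof -
  define E where "E = disc_proj d P x"
  define T where "T = P - E - Q"
  have "E \<in> homogeneous d" using assms(2) by (simp add: E_def homogeneous_disc_proj)
  have PE: "P - E \<in> disc_at d x"
    using diff_disc_proj_in_disc_at[OF assms(1-3)] by (simp add: E_def)
  then have T: "T \<in> disc_at d x"
    using assms(4) by (simp add: T_def disc_at_def homogeneous_diff grad_diff)
  have *: "bombieri_inner U E = disc_form d P U x" if "U \<in> homogeneous d" for U
    using that assms by (simp add: E_def bombieri_inner_disc_proj)
  have "bombieri_inner T E = 0"
    using T * disc_form_disc_at[OF T] by (simp add: disc_at_def)
  moreover have "bombieri_inner E E = disc_form d P P x"
    using *[OF \<open>E \<in> homogeneous d\<close>] disc_form_disc_at[OF PE, of P] by (simp add: disc_form_linear)
  moreover have "P - Q = E + T" by (simp add: T_def)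
  ultimately show ?thesis
    unfolding T_def[symmetric] E_def[symmetric]
    by (simp add: bombieri_inner_simps bombieri_inner_commute[of E T])
qed

text \<open>Equality leaves a zero square in Pythagoras. This is what makes contact radii
  explicit.\<close>

lemma disc_at_closest_unique:
  assumes "P \<in> homogeneous d" "d > 1" "norm x = 1" "Q \<in> disc_at d x"
    and "bombieri_inner (P - Q) (P - Q) = disc_form d P P x"
  shows "Q - P = - disc_proj d P x"
proof -
  have "P - disc_proj d P x - Q = 0"
    using disc_at_pythagoras[OF assms(1-4)] assms(5) by (simp flip: bombieri_inner_eq_0_iff)
  then show ?thesis by (simp add: algebra_simps)
qed

text \<open>By homogeneity, value and gradient at -x agree with those at x up to sign.\<close>

lemma disc_at_uminus:
  assumes "d > 0"
  shows "disc_at d (- x) = disc_at d x"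
proof -
  have "disc_at d x \<subseteq> disc_at d (- x)" for x :: "real ^ 'n"
    using assms peval_scale[of _ d "-1" x] grad_scale[of _ d "-1" x]
    by (auto simp: disc_at_def)
  from this[of x] this[of "- x"] show ?thesis by auto
qed

section \<open>The distance to the discriminant as a minimum over the sphere\<close>

lemma bombieri_dist_nonneg:
  assumes "S \<noteq> {}"
  shows "bombieri_dist P S \<ge> 0"
  unfolding bombieri_dist_def using assms by (intro cINF_greatest) auto

lemma bombieri_dist_le: "Q \<in> S \<Longrightarrow> bombieri_dist P S \<le> bombieri_norm (P - Q)"
  unfolding bombieri_dist_def by (rule cINF_lower) (auto intro: bdd_belowI2[of _ 0])

lemma zero_in_disc_at: "0 \<in> disc_at d x"
  by (simp add: disc_at_def vec_eq_iff)

lemma vec_sphere_nonempty: "sphere (0 :: real ^ 'n) 1 \<noteq> {}"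
  using norm_axis_1 by (metis dist_0_norm empty_iff mem_sphere)

lemma real_disc_nonempty: "real_disc d \<noteq> ({} :: 'n::finite mpoly set)"
  using zero_in_disc_at vec_sphere_nonempty unfolding real_disc_def by blast

lemma real_disc_dist_le:
  assumes "P \<in> homogeneous d" "d > 1" "norm x = 1"
  shows "(bombieri_dist P (real_disc d))\<^sup>2 \<le> disc_form d P P x"
proof -
  let ?Q = "P - disc_proj d P x"
  have Q: "?Q \<in> disc_at d x" by (rule diff_disc_proj_in_disc_at[OF assms])
  then have "?Q \<in> real_disc d" using assms(3) by (auto simp: real_disc_def)
  from bombieri_dist_le[OF this] have "(bombieri_dist P (real_disc d))\<^sup>2 \<le> (bombieri_norm (P - ?Q))\<^sup>2"
    by (intro power_mono bombieri_dist_nonneg real_disc_nonempty)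
  also have "\<dots> = disc_form d P P x"
    using disc_at_pythagoras[OF assms Q] by simp
  finally show ?thesis .
qed

text \<open>The continuous \<open>disc_form d P P\<close> has a minimum on the compact sphere; by
  Pythagoras no element of any \<open>disc_at d y\<close> is closer than that.\<close>

lemma real_disc_dist_attained:
  assumes "P \<in> homogeneous d" "d > 1"
  obtains x where "norm x = 1" "(bombieri_dist P (real_disc d))\<^sup>2 = disc_form d P P x"
proof -
  obtain x where x: "x \<in> sphere 0 1" "\<forall>y\<in>sphere 0 1. disc_form d P P x \<le> disc_form d P P y"
    using continuous_attains_inf[OF compact_sphere vec_sphere_nonempty continuous_on_disc_form] by metis
  have "sqrt (disc_form d P P x) \<le> bombieri_norm (P - Q)" if "Q \<in> real_disc d" for Q
  proof -
    from that obtain y where y: "y \<in> sphere 0 1" "Q \<in> disc_at d y" by (auto simp: real_disc_def)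
    have "disc_form d P P x \<le> disc_form d P P y" using x y by auto
    also have "\<dots> \<le> bombieri_inner (P - Q) (P - Q)"
      using disc_at_pythagoras[OF assms _ y(2)] y(1) by simp
    finally show ?thesis by (simp add: bombieri_norm_def)
  qed
  then have "sqrt (disc_form d P P x) \<le> bombieri_dist P (real_disc d)"
    unfolding bombieri_dist_def by (intro cINF_greatest real_disc_nonempty)
  then have "(sqrt (disc_form d P P x))\<^sup>2 \<le> (bombieri_dist P (real_disc d))\<^sup>2"
    by (rule power_mono) (simp add: disc_form_nonneg)
  then have "disc_form d P P x \<le> (bombieri_dist P (real_disc d))\<^sup>2"
    by (simp add: disc_form_nonneg)
  with real_disc_dist_le[OF assms, of x] x(1) show ?thesis by (intro that[of x]) auto
qed

lemma quasi_singular_iff: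
  "quasi_singular d P x \<longleftrightarrow> norm x = 1 \<and> (bombieri_dist P (real_disc d))\<^sup>2 = disc_form d P P x"
  by (simp add: quasi_singular_def disc_form_self)

text \<open>The contact polynomial realizes the distance to \<open>disc_at d c\<close>, so
  uniqueness determines it. It also lies in \<open>disc_at d (- c)\<close>, so the radius chosen for
  one point of a pair serves the other.\<close>

lemma contact_radius_eq:
  assumes "P \<in> homogeneous d" "d > 1" "contact_radius d P c R"
  shows "R = - disc_proj d P c" and "quasi_singular d P (- c) \<Longrightarrow> R = - disc_proj d P (- c)"
proof -
  obtain Q where Q: "quasi_singular d P c" "Q \<in> disc_at d c"
    "bombieri_norm (Q - P) = bombieri_dist P (real_disc d)" and R: "R = Q - P"
    using assms(3) by (auto simp: contact_radius_def contact_polynomial_def)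
  have *: "R = - disc_proj d P y" if "quasi_singular d P y" "Q \<in> disc_at d y" for y
    unfolding R using that assms(1,2)
    by (intro disc_at_closest_unique)
      (simp_all add: quasi_singular_iff flip: bombieri_norm_power2 Q(3) bombieri_norm_minus_commute[of P])
  show "R = - disc_proj d P c" using Q by (intro *)
  show "R = - disc_proj d P (- c)" if "quasi_singular d P (- c)"
    using that Q(2) assms(2) by (intro *) (simp_all add: disc_at_uminus)
qed

subsection \<open>Perturbations\<close>

text \<open>Local maximality speaks of unit vectors only. Both sides of the inequality are quadratic
  in \<open>Q\<close>, so it can be stated for \<open>Q\<close> before normalization.\<close>

lemma locally_max_dist_perturb:
  assumes "P \<in> homogeneous d" "d > 1" "bombieri_norm P = 1" "locally_max_dist d P"
  obtains \<delta> where "\<delta> > 0"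
    "\<And>Q. Q \<in> homogeneous d \<Longrightarrow> bombieri_norm (Q - P) < \<delta> \<Longrightarrow>
      \<exists>x. norm x = 1 \<and> disc_form d Q Q x \<le> (bombieri_dist P (real_disc d))\<^sup>2 * bombieri_inner Q Q"
proof -
  obtain \<epsilon> where "\<epsilon> > 0" and \<epsilon>: "\<And>Q. Q \<in> homogeneous d \<Longrightarrow> bombieri_norm Q = 1 \<Longrightarrow>
      bombieri_norm (Q - P) < \<epsilon> \<Longrightarrow> bombieri_dist Q (real_disc d) \<le> bombieri_dist P (real_disc d)"
    using assms(4) unfolding locally_max_dist_def by metis
  \<comment> \<open>Normalizing moves \<open>Q\<close> by at most its distance to \<open>P\<close>,
    hence half of \<epsilon>; the bound 1 keeps \<open>Q\<close> nonzero.\<close>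
  show thesis
  proof (rule that[of "min (\<epsilon> / 2) 1"])
    fix Q assume Q: "Q \<in> homogeneous d" "bombieri_norm (Q - P) < min (\<epsilon> / 2) 1"
    let ?n = "bombieri_norm Q"
    have le1: "1 \<le> ?n + bombieri_norm (Q - P)"
      using bombieri_norm_triangle[of Q "P - Q"] assms(3) by (simp add: bombieri_norm_minus_commute)
    then have n: "?n > 0" using Q(2) by auto
    have le2: "?n \<le> 1 + bombieri_norm (Q - P)"
      using bombieri_norm_triangle[of P "Q - P"] assms(3) by simp
    define T where "T = smult_mpoly (1 / ?n) Q"
    have T: "T \<in> homogeneous d" "bombieri_norm T = 1"
      using Q(1) n by (simp_all add: T_def homogeneous_smult bombieri_norm_smult)
    have "T - Q = smult_mpoly (1 / ?n - 1) Q"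
      by (rule poly_mapping_eqI) (simp add: T_def lookup_minus algebra_simps)
    then have "bombieri_norm (T - Q) = \<bar>1 / ?n - 1\<bar> * \<bar>?n\<bar>"
      by (simp add: bombieri_norm_smult)
    also have "\<dots> = \<bar>1 - ?n\<bar>" using n by (simp add: field_simps flip: abs_mult)
    also have "\<dots> \<le> bombieri_norm (Q - P)" using le1 le2 by linarith
    finally have "bombieri_norm (T - P) < \<epsilon>"
      using bombieri_norm_triangle[of "T - Q" "Q - P"] Q(2) by simp
    with T have le: "bombieri_dist T (real_disc d) \<le> bombieri_dist P (real_disc d)" by (intro \<epsilon>)
    obtain x where x: "norm x = 1" "(bombieri_dist T (real_disc d))\<^sup>2 = disc_form d T T x"
      using real_disc_dist_attained[OF T(1) assms(2)] .
    have "disc_form d Q Q x = disc_form d T T x * ?n\<^sup>2"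
      using n by (simp add: T_def disc_form_linear power2_eq_square del: bombieri_norm_power2)
    also have "\<dots> \<le> (bombieri_dist P (real_disc d))\<^sup>2 * ?n\<^sup>2"
      using x(2) le by (intro mult_right_mono)
        (auto simp del: bombieri_norm_power2 simp flip: x(2) intro!: power_mono bombieri_dist_nonneg real_disc_nonempty)
    finally show "\<exists>x. norm x = 1 \<and> disc_form d Q Q x \<le> (bombieri_dist P (real_disc d))\<^sup>2 * bombieri_inner Q Q"
      using x(1) by auto
  qed (use \<open>\<epsilon> > 0\<close> in auto)
qed

text \<open>Finitely many hyperplanes together with the origin form a null set, so some vector
  avoids them; avoiding the origin allows normalization.\<close>

lemma exists_unit_not_orthogonal:
  fixes C :: "'a::euclidean_space set"
  assumes "finite C" "0 \<notin> C"
  obtains e where "norm e = 1" "\<And>c. c \<in> C \<Longrightarrow> e \<bullet> c \<noteq> 0"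
proof -
  have "negligible ({0} \<union> (\<Union>c\<in>C. {e. c \<bullet> e = 0}))"
    using assms by (auto intro!: negligible_Union negligible_hyperplane)
  then obtain v where "v \<notin> {0} \<union> (\<Union>c\<in>C. {e. c \<bullet> e = 0})"
    by (metis UNIV_eq_I non_negligible_UNIV)
  then show thesis
    by (intro that[of "v /\<^sub>R norm v"]) (auto simp: inner_commute)
qed

text \<open>
  Sard's theorem for this family of perturbations: a singular point \<open>x\<close> of \<open>P + \<langle>b, X\<rangle> \<langle>e, X\<rangle>^(d-1)\<close>
  with \<open>\<langle>e, x\<rangle> = 1\<close> determines \<open>b\<close>, so that \<open>b\<close> lies in the image of a hyperplane under a smooth map
  between spaces of equal dimension. Singular points with \<open>\<langle>e, x\<rangle> = 0\<close> are excluded by compactness.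
\<close>

lemma exists_nonsingular_perturbation:
  fixes P :: "'n::finite mpoly"
  assumes P: "P \<in> homogeneous d" and d: "d > 1" and "\<delta> > 0" and e: "norm e = 1"
    and sing: "\<And>x. norm x = 1 \<Longrightarrow> grad P x = 0 \<Longrightarrow> e \<bullet> x \<noteq> 0"
  obtains Q where "Q \<in> homogeneous d" "bombieri_norm (Q - P) < \<delta>"
    "\<And>x. norm x = 1 \<Longrightarrow> grad Q x \<noteq> 0"
proof -
  define K where "K = sphere 0 1 \<inter> {x. e \<bullet> x = 0}"
  have "compact K"
    unfolding K_def by (intro compact_Int_closed closed_hyperplane) simp
  obtain \<eta> where "\<eta> > 0" and \<eta>: "\<And>x. x \<in> K \<Longrightarrow> \<eta> \<le> norm (grad P x)"
  proof (cases "K = {}")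
    case False
    have "continuous_on K (\<lambda>x. norm (grad P x))" by (intro continuous_intros)
    from continuous_attains_inf[OF \<open>compact K\<close> False this]
    obtain x where "x \<in> K" "\<forall>y\<in>K. norm (grad P x) \<le> norm (grad P y)" by blast
    moreover from this have "grad P x \<noteq> 0" using sing[of x] by (auto simp: K_def)
    ultimately show thesis by (intro that[of "norm (grad P x)"]) auto
  qed (auto intro: that[of 1])
  \<comment> \<open>Solving for b: with \<langle>e, x\<rangle> = 1, vanishing of Q gives \<langle>b,
    x\<rangle> = -P(x), and vanishing of its gradient then gives b = G(x).\<close>
  define G where "G x = (real (d - 1) * peval P x) *\<^sub>R e - grad P x" for x
  have "G differentiable_on {x. e \<bullet> x = 1}"
    unfolding G_def[abs_def]
    by (intro differentiable_on_diff differentiable_on_scaleR differentiable_on_mult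
        differentiable_on_const grad_differentiable) (simp add: differentiable_on_def peval_differentiable)
  then have "negligible (G ` {x. e \<bullet> x = 1})"
    by (intro negligible_differentiable_image_negligible negligible_hyperplane) auto
  \<comment> \<open>The bound \<delta> keeps Q close to P; \<eta>/d keeps the gradient of the
    perturbation below \<eta> on \<open>K\<close>.\<close>
  moreover define r where "r = min \<delta> (\<eta> / real d)"
  have "r > 0" using \<open>\<delta> > 0\<close> \<open>\<eta> > 0\<close> d by (simp add: r_def)
  ultimately have "\<not> ball 0 r \<subseteq> G ` {x. e \<bullet> x = 1}"
    by (metis ball_eq_empty negligible_subset not_le open_ball open_not_negligible)
  then obtain b where "b \<in> ball 0 r" and b: "b \<notin> G ` {x. e \<bullet> x = 1}" by blast
  then have "norm b < r" by simp
  define L where "L = tangent_poly d b e"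
  define Q where "Q = P + L"
  have L: "L \<in> homogeneous d" using d by (simp add: L_def homogeneous_tangent_poly)
  then have Q: "Q \<in> homogeneous d" using P by (simp add: Q_def homogeneous_add)
  have ee: "e \<bullet> e = 1" using e by (simp add: dot_square_norm)
  have "bombieri_inner L L = (b \<bullet> b + real (d - 1) * (b \<bullet> e)\<^sup>2) / real d"
    using bombieri_inner_tangent_poly[OF L, of b e] d
    by (simp add: grad_tangent_poly ee L_def inner_simps power2_eq_square mult_ac)
  also have "\<dots> \<le> (b \<bullet> b + real (d - 1) * (b \<bullet> b)) / real d"
    using Cauchy_Schwarz_ineq[of b e]
    by (intro divide_right_mono add_left_mono mult_left_mono) (auto simp: ee)
  also have "\<dots> = (norm b)\<^sup>2"
    using d by (simp add: dot_square_norm of_nat_diff field_simps)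
  finally have "bombieri_norm L \<le> norm b"
    unfolding bombieri_norm_def by (intro real_le_lsqrt) auto
  moreover have "Q - P = L" by (simp add: Q_def)
  ultimately have near: "bombieri_norm (Q - P) < \<delta>"
    using \<open>norm b < r\<close> by (simp add: r_def)
  have "grad Q x \<noteq> 0" if x: "norm x = 1" for x
  proof
    assume Q0: "grad Q x = 0"
    show False
    proof (cases "e \<bullet> x = 0")
      case True
      have "norm (grad L x) \<le> real (d - 1) * norm b"
      proof -
        \<comment> \<open>With \<langle>e, x\<rangle> = 0 only the term along \<open>e\<close> is
          left. Its factor 0^(d-2) is 1 for d = 2 and 0 otherwise.\<close>
        have "norm (grad L x) \<le> real (d - 1) * (\<bar>b \<bullet> x\<bar> * \<bar>0 ^ (d - 2)\<bar>)"
          using d True by (simp add: L_def grad_tangent_poly e abs_mult zero_power)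
        also have "\<dots> \<le> real (d - 1) * (norm b * 1)"
          using Cauchy_Schwarz_ineq2[of b x] x
          by (intro mult_left_mono mult_mono) (auto simp: power_0_left)
        finally show ?thesis by simp
      qed
      also have "\<dots> \<le> real d * norm b" by (intro mult_right_mono) auto
      also have "\<dots> < \<eta>" using \<open>norm b < r\<close> d by (simp add: r_def field_simps)
      also have "\<eta> \<le> norm (grad P x)" using \<eta> x True by (simp add: K_def)
      also have "grad P x = - grad L x"
        using Q0 by (simp add: Q_def grad_add eq_neg_iff_add_eq_0)
      finally show False by simp
    next
      case False
      \<comment> \<open>Rescaling moves the singular point to the affine hyperplane on which
        \<open>G\<close> was considered.\<close>
      define y where "y = (1 / (e \<bullet> x)) *\<^sub>R x"
      have y: "e \<bullet> y = 1" using False by (simp add: y_def)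
      have gQ: "grad Q y = 0"
        using grad_scale[OF Q] d Q0 by (simp add: y_def)
      then have "peval Q y = 0" using inner_grad[OF Q, of y] d by simp
      then have b_y: "b \<bullet> y = - peval P y" using y by (simp add: Q_def L_def)
      have "grad P y + (b - (real (d - 1) * peval P y) *\<^sub>R e) = 0"
        using gQ by (simp add: Q_def L_def grad_add grad_tangent_poly y b_y)
      then have "b - G y = 0" by (simp add: G_def algebra_simps)
      then have "b = G y" by simp
      with b y show False by blast
    qed
  qed
  with Q near show thesis by (rule that)
qed

text \<open>By compactness max(A, B) has a lower bound r > 0. Where A \<ge> r, the other terms are
  smaller than r; elsewhere B \<ge> r outweighs t C and A \<ge> 0 helps.\<close>

lemma quadratic_perturbation_pos:
  fixes A B C :: "'a::topological_space \<Rightarrow> real"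
  assumes "compact S" and cont: "continuous_on S A" "continuous_on S B" "continuous_on S C"
    and A: "\<And>x. x \<in> S \<Longrightarrow> A x \<ge> 0" and B: "\<And>x. x \<in> S \<Longrightarrow> A x = 0 \<Longrightarrow> B x > 0"
  obtains t0 where "t0 > 0"
    "\<And>t x. 0 < t \<Longrightarrow> t < t0 \<Longrightarrow> x \<in> S \<Longrightarrow> A x + t * B x + t\<^sup>2 * C x > 0"
proof (cases "S = {}")
  case False
  have "continuous_on S (\<lambda>x. max (A x) (B x))" by (intro continuous_intros cont)
  from continuous_attains_inf[OF assms(1) False this]
  obtain x0 where x0: "x0 \<in> S" "\<And>x. x \<in> S \<Longrightarrow> max (A x0) (B x0) \<le> max (A x) (B x)" by blast
  define r where "r = max (A x0) (B x0)"
  have "r > 0" using A[OF x0(1)] B[OF x0(1)] by (cases "A x0 = 0") (auto simp: r_def)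
  have "continuous_on S (\<lambda>x. \<bar>B x\<bar> + \<bar>C x\<bar>)" by (intro continuous_intros cont)
  from continuous_attains_sup[OF assms(1) False this]
  obtain x1 where x1: "\<And>x. x \<in> S \<Longrightarrow> \<bar>B x\<bar> + \<bar>C x\<bar> \<le> \<bar>B x1\<bar> + \<bar>C x1\<bar>" by blast
  \<comment> \<open>The summand 1 makes the divisor in r / M positive.\<close>
  define M where "M = \<bar>B x1\<bar> + \<bar>C x1\<bar> + 1"
  have "M > 0" by (simp add: M_def)
  show thesis
  proof (rule that[of "min 1 (r / M)"])
    fix t x assume t: "0 < t" "t < min 1 (r / M)" and x: "x \<in> S"
    have M: "\<bar>B x\<bar> + \<bar>C x\<bar> \<le> M" using x1[OF x] by (simp add: M_def)
    have tM: "t * M < r" using t \<open>M > 0\<close> by (simp add: field_simps)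
    show "A x + t * B x + t\<^sup>2 * C x > 0"
    proof (cases "A x \<ge> r")
      case True
      have "\<bar>t * B x + t\<^sup>2 * C x\<bar> \<le> t * \<bar>B x\<bar> + t * (t * \<bar>C x\<bar>)"
        using t(1) abs_triangle_ineq[of "t * B x" "t\<^sup>2 * C x"] by (simp add: abs_mult power2_eq_square)
      also have "\<dots> \<le> t * \<bar>B x\<bar> + t * (1 * \<bar>C x\<bar>)"
        using t by (intro add_left_mono mult_left_mono mult_right_mono) auto
      also have "\<dots> \<le> t * M" using M t by (simp flip: distrib_left)
      finally show ?thesis using tM True by linarith
    next
      case False
      then have Br: "B x \<ge> r" using x0(2)[OF x] by (simp add: r_def max_def split: if_splits)
      have "t * \<bar>C x\<bar> \<le> t * M" using M t by (intro mult_left_mono) auto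
      moreover have "t * - \<bar>C x\<bar> \<le> t * C x" using t by (intro mult_left_mono) auto
      ultimately have "- r < t * C x" using tM by simp
      with Br have "0 < t * (B x + t * C x)" using t by (intro mult_pos_pos) auto
      then show ?thesis using A[OF x] by (simp add: power2_eq_square algebra_simps)
    qed
  qed (use \<open>r > 0\<close> \<open>M > 0\<close> in auto)
qed (auto intro: that[of 1])

text \<open>Gram--Schmidt; when \<open>S\<close> vanishes, division by zero makes \<open>s\<close> vanish as well.\<close>

lemma exists_orthogonal_remainder:
  "\<exists>a. \<forall>j\<in>{1..k::nat}. bombieri_inner (P - (\<Sum>i=1..k. smult_mpoly (a i) (R i))) (R j) = 0"
proof (induction k arbitrary: P)
  case (Suc k)
  obtain a where a: "\<And>j. j \<in> {1..k} \<Longrightarrow> bombieri_inner (P - (\<Sum>i=1..k. smult_mpoly (a i) (R i))) (R j) = 0"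
    using Suc by blast
  \<comment> \<open>The induction hypothesis is general in \<open>P\<close>, so it also
    orthogonalizes the new vector \<open>R (Suc k)\<close>.\<close>
  obtain b where b: "\<And>j. j \<in> {1..k} \<Longrightarrow>
      bombieri_inner (R (Suc k) - (\<Sum>i=1..k. smult_mpoly (b i) (R i))) (R j) = 0"
    using Suc by blast
  define U where "U = P - (\<Sum>i=1..k. smult_mpoly (a i) (R i))"
  define S where "S = R (Suc k) - (\<Sum>i=1..k. smult_mpoly (b i) (R i))"
  define s where "s = bombieri_inner U S / bombieri_inner S S"
  \<comment> \<open>Coefficients of U - s S after expanding S in terms of the
    \<open>R i\<close>.\<close>
  define a' where "a' i = (if i = Suc k then s else a i - s * b i)" for i
  have "P - (\<Sum>i=1..Suc k. smult_mpoly (a' i) (R i)) = U - smult_mpoly s S"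
    by (rule poly_mapping_eqI)
      (simp add: U_def S_def a'_def lookup_minus lookup_add lookup_sum algebra_simps
        sum_subtractf sum_distrib_left)
  moreover have "bombieri_inner (U - smult_mpoly s S) (R j) = 0" if "j \<in> {1..k}" for j
    using a[OF that, folded U_def] b[OF that, folded S_def]
    by (simp only: bombieri_inner_simps mult_zero_right diff_zero)
  moreover have "bombieri_inner (U - smult_mpoly s S) (R (Suc k)) = 0"
  proof -
    have "R (Suc k) = S + (\<Sum>i=1..k. smult_mpoly (b i) (R i))" by (simp add: S_def)
    moreover have "bombieri_inner U S = s * bombieri_inner S S"
      by (cases "S = 0") (auto simp: s_def bombieri_inner_eq_0_iff)
    ultimately show ?thesis
      using a[folded U_def] b[folded S_def] by (simp add: bombieri_inner_simps bombieri_inner_sum_right)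
  qed
  ultimately show ?case
    by (intro exI[of _ a']) (auto simp: le_Suc_eq)
qed simp

theorem theorem7p1:
  fixes P :: "'n::finite mpoly"
    and d k :: nat
    and c :: "nat \<Rightarrow> real ^ 'n"
    and R :: "nat \<Rightarrow> 'n mpoly"
  assumes "CARD('n) > 1"
    and "d > 1"
    and "P \<in> homogeneous d"
    and "bombieri_norm P = 1"
    and "locally_max_dist d P"
    and "{x. quasi_singular d P x} = (\<Union>i\<in>{1..k}. {c i, - c i})"
    and "\<And>i. i \<in> {1..k} \<Longrightarrow> contact_radius d P (c i) (R i)"
  shows "\<exists>a :: nat \<Rightarrow> real. P = (\<Sum>i=1..k. smult_mpoly (a i) (R i))"
proof -
  note d = assms(2) and P = assms(3)
  define D where "D = (bombieri_dist P (real_disc d))\<^sup>2"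
  have qs: "quasi_singular d P x \<longleftrightarrow> norm x = 1 \<and> disc_form d P P x = D" for x
    by (auto simp: quasi_singular_iff D_def)
  obtain r where "r > 0" and r: "\<And>Q. Q \<in> homogeneous d \<Longrightarrow> bombieri_norm (Q - P) < r \<Longrightarrow>
      \<exists>x. norm x = 1 \<and> disc_form d Q Q x \<le> D * bombieri_inner Q Q"
    using locally_max_dist_perturb[OF P d assms(4,5)] unfolding D_def by metis
  have "D > 0"
  proof (rule ccontr)
    assume "\<not> D > 0"
    then have "D = 0" by (simp add: D_def)
    \<comment> \<open>For D = 0 the quasi-singular points are the singular points on the sphere; the
      list of pairs shows that they are finitely many.\<close>
    have "finite {x. quasi_singular d P x}" unfolding assms(6) by simp
    moreover have "0 \<notin> {x. quasi_singular d P x}" by (simp add: qs)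
    ultimately obtain e where e: "norm e = 1" "\<And>x. x \<in> {x. quasi_singular d P x} \<Longrightarrow> e \<bullet> x \<noteq> 0"
      by (rule exists_unit_not_orthogonal) blast
    have "e \<bullet> x \<noteq> 0" if "norm x = 1" "grad P x = 0" for x
      using that disc_form_eq_0_iff[OF P, of x] d \<open>D = 0\<close> by (intro e(2)) (simp add: qs)
    then obtain Q where Q: "Q \<in> homogeneous d" "bombieri_norm (Q - P) < r"
      and nonsing: "\<And>x. norm x = 1 \<Longrightarrow> grad Q x \<noteq> 0"
      using exists_nonsingular_perturbation[OF P d \<open>r > 0\<close> e(1)] by blast
    from r[OF Q] obtain x where "norm x = 1" "disc_form d Q Q x \<le> 0"
      using \<open>D = 0\<close> by auto
    then show False
      using nonsing[of x] disc_form_nonneg[of d Q x] disc_form_eq_0_iff[OF Q(1), of x] d by simp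
  qed
  obtain a where a: "\<And>j. j \<in> {1..k} \<Longrightarrow>
      bombieri_inner (P - (\<Sum>i=1..k. smult_mpoly (a i) (R i))) (R j) = 0"
    using exists_orthogonal_remainder[of k P R] by blast
  define N where "N = P - (\<Sum>i=1..k. smult_mpoly (a i) (R i))"
  define n where "n = bombieri_inner N N"
  have R: "R i \<in> homogeneous d" if "i \<in> {1..k}" for i
    using contact_radius_eq(1)[OF P d assms(7)[OF that]] d
      homogeneous_diff[OF homogeneous_0 homogeneous_disc_proj, of d P "c i"] by simp
  then have N: "N \<in> homogeneous d"
    unfolding N_def by (intro homogeneous_diff homogeneous_sum homogeneous_smult P)
  have "P = N + (\<Sum>i=1..k. smult_mpoly (a i) (R i))" by (simp add: N_def)
  then have "bombieri_inner N P = n + (\<Sum>i=1..k. a i * bombieri_inner N (R i))"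
    unfolding n_def by (metis (no_types, lifting) bombieri_inner_add_right bombieri_inner_smult_right
        bombieri_inner_sum_right sum.cong)
  then have NP: "bombieri_inner N P = n" using a by (simp add: N_def)
  \<comment> \<open>At either point of a pair, \<open>R i\<close> is minus the projection term, and
    pairing with that term is \<open>disc_form d P\<close>. Orthogonality to \<open>R i\<close> is
    thus stationarity along \<open>N\<close>.\<close>
  have orth: "disc_form d P N x = 0" if x: "quasi_singular d P x" for x
  proof -
    from x assms(6) obtain i where i: "i \<in> {1..k}" "x = c i \<or> x = - c i" by blast
    then have "R i = - disc_proj d P x"
      using contact_radius_eq[OF P d assms(7)[OF i(1)]] x by auto
    then have "bombieri_inner N (disc_proj d P x) = 0"
      using a[OF i(1)] bombieri_inner_diff_right[of N 0 "disc_proj d P x"] by (simp add: N_def)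
    then show ?thesis using bombieri_inner_disc_proj[OF N, of x P] x d by (simp add: qs)
  qed
  have "N = 0"
  proof (rule ccontr)
    assume "N \<noteq> 0"
    then have "n > 0"
      using bombieri_inner_nonneg[of N] bombieri_inner_eq_0_iff[of N] by (simp add: n_def less_le)
    have cont: "continuous_on (sphere 0 1) (\<lambda>x. disc_form d P P x - D)"
      "continuous_on (sphere 0 1) (\<lambda>x. 2 * (D * n - disc_form d P N x))"
      "continuous_on (sphere 0 1) (\<lambda>x. disc_form d N N x - D * n)"
      by (intro continuous_intros continuous_on_disc_form)+
    \<comment> \<open>This is \<open>disc_form d Q Q x\<close> - D\<langle>Q, Q\<rangle> for Q = P -
      t N, expanded in powers of t. Its constant term vanishes only at quasi-singular points, where
      the linear coefficient is 2 D n > 0.\<close>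
    obtain t0 where "t0 > 0" and t0: "\<And>t x. 0 < t \<Longrightarrow> t < t0 \<Longrightarrow> x \<in> sphere 0 1 \<Longrightarrow>
        disc_form d P P x - D + t * (2 * (D * n - disc_form d P N x)) + t\<^sup>2 * (disc_form d N N x - D * n) > 0"
    proof (rule quadratic_perturbation_pos[OF compact_sphere cont])
      show "0 \<le> disc_form d P P x - D" if "x \<in> sphere 0 1" for x
        using real_disc_dist_le[OF P d, of x] that by (simp add: D_def)
      show "0 < 2 * (D * n - disc_form d P N x)" if "x \<in> sphere 0 1" "disc_form d P P x - D = 0" for x
        using orth[of x] that \<open>D > 0\<close> \<open>n > 0\<close> by (simp add: qs)
    qed blast
    have bN: "bombieri_norm N > 0" using \<open>n > 0\<close> by (simp add: bombieri_norm_def n_def)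
    \<comment> \<open>Halving makes t strictly less than \<open>t0\<close> and puts Q strictly
      within r of P.\<close>
    define t where "t = min t0 (r / bombieri_norm N) / 2"
    have t: "0 < t" "t < t0" "t < r / bombieri_norm N"
      using \<open>t0 > 0\<close> \<open>r > 0\<close> bN by (auto simp: t_def min_def field_simps)
    define Q where "Q = P - smult_mpoly t N"
    have "Q \<in> homogeneous d" unfolding Q_def by (intro homogeneous_diff homogeneous_smult P N)
    moreover have "bombieri_norm (Q - P) < r"
    proof -
      have "bombieri_norm (Q - P) = bombieri_norm (smult_mpoly t N)"
        by (subst bombieri_norm_minus_commute) (simp add: Q_def)
      then show ?thesis using t bN by (simp add: bombieri_norm_smult field_simps)
    qed
    ultimately obtain x where x: "norm x = 1" "disc_form d Q Q x \<le> D * bombieri_inner Q Q"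
      using r by blast
    have "bombieri_inner P P = 1" using assms(4) by (simp flip: bombieri_norm_power2)
    then have "bombieri_inner Q Q = 1 - 2 * t * n + t\<^sup>2 * n"
      using NP bombieri_inner_commute[of P N]
      by (simp add: Q_def bombieri_inner_simps n_def power2_eq_square algebra_simps)
    moreover have "disc_form d Q Q x = disc_form d P P x - 2 * t * disc_form d P N x + t\<^sup>2 * disc_form d N N x"
      by (simp add: Q_def disc_form_linear disc_form_commute[of d N P] power2_eq_square algebra_simps)
    ultimately have "disc_form d Q Q x - D * bombieri_inner Q Q
        = disc_form d P P x - D + t * (2 * (D * n - disc_form d P N x)) + t\<^sup>2 * (disc_form d N N x - D * n)"
      by (simp only:) (simp add: algebra_simps)
    then show False
      using t0[OF t(1,2), of x] x by simp
  qed
  then show ?thesis by (auto simp: N_def)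
qed

end
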